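(* Let $p$ be a prime with $p\equiv 15$ or $27\pmod{28}$. For all integers $m,n,k\geq 0$ with $p\nmid n$, \[ c_{11,3}\left(2^{3k+3}p^{2m+1}n+\frac{3\cdot 2^{3k+3}p^{2m+2}+4}{7}\right)\equiv 0\pmod 2. \]
   Context: For complex $a,b$ the false theta function is $\Psi(a,b):=\sum_{n=0}^\infty a^{n(n+1)/2}b^{n(n-1)/2}-\sum_{n=-\infty}^{-1}a^{n(n+1)/2}b^{n(n-1)/2}$. For positive integers $r,s$, the integers $c_{r,s}(n)$ ($n\ge 0$) are defined by the power series identity $\sum_{n=0}^\infty c_{r,s}(n)q^n=\dfrac{1}{\Psi(-q^r,q^s)}$ (the denominator is a power series in $q$ with constant term $1$). *)

theory Defs
  imports
    "HOL-Analysis.Analysis"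
    "HOL-Computational_Algebra.Formal_Power_Series"
    "HOL-Number_Theory.Cong"
begin

text \<open>
  The false theta function. The definition is polymorphic so that it covers both complex
  arguments and formal power series (whose metric is the one of \<^theory>\<open>HOL-Computational_Algebra.Formal_Power_Series\<close>,
  i.e. the X-adic one). Both \<open>n * (n + 1) div 2\<close> and \<open>n * (n - 1) div 2\<close> are exact and
  nonnegative for every integer \<open>n\<close>, so \<open>nat\<close> does not truncate.
\<close>

definition false_theta :: "'a::{comm_ring_1,t2_space} \<Rightarrow> 'a \<Rightarrow> 'a" where
  "false_theta a b =
     (\<Sum>\<^sub>\<infinity>n\<in>{0::int..}. a ^ nat (n * (n + 1) div 2) * b ^ nat (n * (n - 1) div 2)) -
     (\<Sum>\<^sub>\<infinity>n\<in>{..-1::int}. a ^ nat (n * (n + 1) div 2) * b ^ nat (n * (n - 1) div 2))"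

text \<open>
  The integer coefficients of the reciprocal of the series \<open>\<Psi>(-q\<^sup>r, q\<^sup>s)\<close>, with \<open>q\<close> the
  formal variable. Lemma \<open>ex1_false_theta_coeff\<close> below justifies the description operator
  for positive \<open>r\<close> and \<open>s\<close>.
\<close>

definition false_theta_coeff :: "nat \<Rightarrow> nat \<Rightarrow> nat \<Rightarrow> int" where
  "false_theta_coeff r s =
     (THE c. Abs_fps c * false_theta (- (fps_X ^ r)) (fps_X ^ s) = 1)"

lemma has_sum_fps:
  fixes f :: "'i \<Rightarrow> 'a::comm_ring_1 fps"
  assumes fin: "\<And>k. finite {i\<in>A. fps_nth (f i) k \<noteq> 0}"
  shows "(f has_sum Abs_fps (\<lambda>k. \<Sum>i | i \<in> A \<and> fps_nth (f i) k \<noteq> 0. fps_nth (f i) k)) A"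
    (is "(f has_sum ?S) A")
  unfolding has_sum_def
proof (rule metric_tendsto_imp_tendsto[where f = "\<lambda>F. dist (sum f F) ?S" and a = 0, THEN tendsto_dist_iff[THEN iffD2]])
  show "((\<lambda>F. dist (sum f F) ?S) \<longlongrightarrow> 0) (finite_subsets_at_top A)"
  proof (rule tendstoI)
    fix e :: real assume e: "e > 0"
    obtain N where N: "inverse (2 ^ N) < e"
      using e reals_power_lt_ex[of e 2] by (auto simp: field_simps)
    define F0 where "F0 = (\<Union>k\<le>N. {i\<in>A. fps_nth (f i) k \<noteq> 0})"
    have F0: "finite F0" "F0 \<subseteq> A" using fin by (auto simp: F0_def)
    have "dist (sum f F) ?S < e" if F: "finite F" "F0 \<subseteq> F" "F \<subseteq> A" for F
    proof -
      have eq: "fps_nth (sum f F) k = fps_nth ?S k" if "k \<le> N" for k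
      proof -
        have "{i\<in>A. fps_nth (f i) k \<noteq> 0} \<subseteq> F" using F(2) that by (auto simp: F0_def)
        hence "(\<Sum>i | i \<in> A \<and> fps_nth (f i) k \<noteq> 0. fps_nth (f i) k) = (\<Sum>i\<in>F. fps_nth (f i) k)"
          using F by (intro sum.mono_neutral_left) auto
        thus ?thesis by (simp add: fps_sum_nth)
      qed
      have "dist (sum f F) ?S < inverse (2 ^ N)"
        using eq by (intro nth_equal_imp_dist_less) auto
      thus ?thesis using N by linarith
    qed
    thus "\<forall>\<^sub>F F in finite_subsets_at_top A. dist (dist (sum f F) ?S) 0 < e"
      unfolding eventually_finite_subsets_at_top using F0 by (auto intro!: exI[of _ F0])
  qed
qed auto

lemma false_theta_term_nth:
  fixes n :: int
  defines "u \<equiv> nat (n * (n + 1) div 2)" and "v \<equiv> nat (n * (n - 1) div 2)"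
  shows "fps_nth ((- (fps_X ^ r)) ^ u * (fps_X ^ s) ^ v :: int fps) k =
           (if k = r * u + s * v then (-1) ^ u else 0)"
proof -
  have "(-1 :: int fps) ^ u = fps_const ((-1) ^ u)"
    by (cases "even u") (simp_all add: fps_eq_iff)
  hence "(- (fps_X ^ r)) ^ u * (fps_X ^ s) ^ v =
           fps_const ((-1) ^ u) * (fps_X :: int fps) ^ (r * u + s * v)"
    by (subst power_minus) (simp add: power_add power_mult mult.assoc)
  thus ?thesis by (simp only: fps_mult_left_const_nth fps_X_power_nth) simp
qed

lemma square_le_false_theta_exponent:
  fixes n :: int
  assumes "r > 0" "s > 0"
  shows "n ^ 2 \<le> int (r * nat (n * (n + 1) div 2) + s * nat (n * (n - 1) div 2))"
proof -
  define a b where "a = n * (n + 1) div 2" and "b = n * (n - 1) div 2"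
  have ab: "2 * a = n * (n + 1)" "2 * b = n * (n - 1)" by (simp_all add: a_def b_def)
  have "n * (n + 1) \<ge> 0" "n * (n - 1) \<ge> 0"
    by (auto simp: zero_le_mult_iff)
  hence nn: "a \<ge> 0" "b \<ge> 0" using ab by linarith+
  have "n ^ 2 = a + b" using ab by (simp add: power2_eq_square algebra_simps)
  also have "\<dots> \<le> int r * a + int s * b"
    using nn assms by (intro add_mono) (simp_all add: mult_le_cancel_right1)
  finally show ?thesis using nn by (simp add: a_def b_def)
qed

lemma false_theta_nth:
  assumes "r > 0" "s > 0"
  defines "f \<equiv> (\<lambda>n::int. (- (fps_X ^ r)) ^ nat (n * (n + 1) div 2) *
                          (fps_X ^ s) ^ nat (n * (n - 1) div 2) :: int fps)"
  shows "finite {n. fps_nth (f n) k \<noteq> 0}"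
    and "f summable_on A"
    and "fps_nth (false_theta (- (fps_X ^ r)) (fps_X ^ s)) k =
           (\<Sum>n | n \<ge> 0 \<and> fps_nth (f n) k \<noteq> 0. fps_nth (f n) k) -
           (\<Sum>n | n \<le> -1 \<and> fps_nth (f n) k \<noteq> 0. fps_nth (f n) k)"
proof -
  have fin: "finite {n. fps_nth (f n) k \<noteq> 0}" for k
  proof (rule finite_subset)
    show "{n. fps_nth (f n) k \<noteq> 0} \<subseteq> {-int k..int k}"
    proof
      fix n assume "n \<in> {n. fps_nth (f n) k \<noteq> 0}"
      hence "n ^ 2 \<le> int k"
        using square_le_false_theta_exponent[OF assms(1,2), of n]
        by (auto simp: f_def false_theta_term_nth split: if_splits)
      moreover have "\<bar>n\<bar> \<le> n ^ 2"
        using self_le_power[of "\<bar>n\<bar>" 2] by (cases "n = 0") auto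
      ultimately show "n \<in> {-int k..int k}" by auto
    qed
  qed auto
  thus "finite {n. fps_nth (f n) k \<noteq> 0}" .
  have hs: "(f has_sum Abs_fps (\<lambda>k. \<Sum>n | n \<in> A \<and> fps_nth (f n) k \<noteq> 0. fps_nth (f n) k)) A" for A
    by (rule has_sum_fps) (rule finite_subset[OF _ fin], auto)
  thus "f summable_on A" by (auto simp: summable_on_def)
  have "false_theta (- (fps_X ^ r)) (fps_X ^ s) = infsum f {0..} - infsum f {..-1}"
    by (simp add: false_theta_def f_def)
  thus "fps_nth (false_theta (- (fps_X ^ r)) (fps_X ^ s)) k =
           (\<Sum>n | n \<ge> 0 \<and> fps_nth (f n) k \<noteq> 0. fps_nth (f n) k) -
           (\<Sum>n | n \<le> -1 \<and> fps_nth (f n) k \<noteq> 0. fps_nth (f n) k)"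
    using infsumI[OF hs[of "{0..}"]] infsumI[OF hs[of "{..-1}"]] by simp
qed

lemma false_theta_nth_0:
  assumes "r > 0" "s > 0"
  shows "fps_nth (false_theta (- (fps_X ^ r)) (fps_X ^ s) :: int fps) 0 = 1"
proof -
  define f where "f = (\<lambda>n::int. (- (fps_X ^ r)) ^ nat (n * (n + 1) div 2) *
                          (fps_X ^ s) ^ nat (n * (n - 1) div 2) :: int fps)"
  have f0: "fps_nth (f n) 0 = (if n = 0 then 1 else 0)" for n
  proof (cases "n = 0")
    case False
    hence "0 < n ^ 2" by simp
    hence "0 \<noteq> r * nat (n * (n + 1) div 2) + s * nat (n * (n - 1) div 2)"
      using square_le_false_theta_exponent[OF assms, of n] by linarith
    thus ?thesis using False by (simp only: f_def false_theta_term_nth if_False)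
  qed (simp add: f_def)
  have "fps_nth (false_theta (- (fps_X ^ r)) (fps_X ^ s)) 0 =
          (\<Sum>n | n \<ge> 0 \<and> fps_nth (f n) 0 \<noteq> 0. fps_nth (f n) 0) -
          (\<Sum>n | n \<le> -1 \<and> fps_nth (f n) 0 \<noteq> 0. fps_nth (f n) 0)"
    unfolding f_def by (rule false_theta_nth(3)[OF assms])
  moreover have "{n::int. n \<ge> 0 \<and> fps_nth (f n) 0 \<noteq> 0} = {0}"
    and "{n::int. n \<le> -1 \<and> fps_nth (f n) 0 \<noteq> 0} = {}"
    by (auto simp: f0)
  ultimately show ?thesis by (simp only: f0) simp
qed

lemma ex1_false_theta_coeff:
  assumes "r > 0" "s > 0"
  shows "\<exists>!c :: nat \<Rightarrow> int. Abs_fps c * false_theta (- (fps_X ^ r)) (fps_X ^ s) = 1"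
proof -
  let ?F = "false_theta (- (fps_X ^ r)) (fps_X ^ s) :: int fps"
  have "fps_left_inverse ?F 1 * ?F = 1"
    by (rule fps_left_inverse) (simp add: false_theta_nth_0[OF assms])
  hence "Abs_fps (fps_nth (fps_left_inverse ?F 1)) * ?F = 1" by (simp only: fps_nth_inverse)
  moreover have "c = d" if "Abs_fps c * ?F = 1" "Abs_fps d * ?F = 1" for c d
  proof -
    have "?F \<noteq> 0" using that by auto
    hence "Abs_fps c = Abs_fps d" using that by (metis mult_cancel_right)
    thus ?thesis by (simp add: fun_eq_iff fps_eq_iff)
  qed
  ultimately show ?thesis by blast
qed

end

theory Submission
  imports Defs "HOL-Library.Z2" "HOL-Number_Theory.Residues"
begin

text \<open>
  Modulo 2 the signs in the false theta function disappear, so \<open>\<Psi>(-q\<^sup>1\<^sup>1, q\<^sup>3)\<close> becomes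
  \<open>F = \<Sum> q^(7n\<^sup>2 + 4n)\<close>, where \<open>7 (7n\<^sup>2 + 4n) = (7n + 2)\<^sup>2 - 4\<close>. Squaring a series modulo 2
  substitutes \<open>q\<^sup>2\<close> for \<open>q\<close>, hence \<open>1 / F = F\<^sup>7 / F\<^sup>8 = F(q) F(q\<^sup>2) F(q\<^sup>4) / F(q\<^sup>8)\<close>. The
  terms of the numerator with exponent \<open>8t + 4\<close> contain a factor \<open>F(q\<^sup>8)\<close>, and after cancellation
  \<open>c(8t + 4)\<close> has the parity of the number of representations of \<open>7t + 3\<close> as
  \<open>(7n + 1)\<^sup>2 + (7m + 3)\<^sup>2\<close>. For the indices in question \<open>7t + 3 = 8\<^sup>k p\<^bsup>2m+1\<^esup> (7n + 3p)\<close> contains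
  the prime \<open>p \<equiv> 3 (mod 4)\<close> to an odd power, so it is not a sum of two squares.
\<close>

text \<open>Keeps \<open>+\<close> and \<open>*\<close> on \<open>bit\<close> as field operations
  for the simplifier.\<close>

declare add_bit_eq_xor [simp del] mult_bit_eq_and [simp del]

section \<open>Counting series and their squares modulo 2\<close>

lemma of_int_bit_eq_0_imp_even:
  assumes "of_int z = (0 :: bit)"
  shows "even z"
proof (rule ccontr)
  assume "odd z"
  then obtain w where w: "z = 2 * w + 1" by (rule oddE)
  have "of_int z = (1 :: bit)" unfolding w by simp
  thus False using assms by simp
qed

text \<open>The formal sum of \<open>X ^ w a\<close> over all \<open>a\<close>. An infinite fibre
  would contribute 0 through \<open>card\<close>, hence the companion notion
  \<open>finite_fibres\<close>.\<close>

definition count_series :: "('i \<Rightarrow> nat) \<Rightarrow> 'a::comm_ring_1 fps" where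
  "count_series w = Abs_fps (\<lambda>k. of_nat (card (w -` {k})))"

definition finite_fibres :: "('i \<Rightarrow> nat) \<Rightarrow> bool" where
  "finite_fibres w \<longleftrightarrow> (\<forall>k. finite (w -` {k}))"

lemma count_series_nth [simp]: "fps_nth (count_series w) k = of_nat (card (w -` {k}))"
  by (simp add: count_series_def)

lemma vimage_sum_weight:
  fixes w :: "'i \<Rightarrow> nat" and v :: "'j \<Rightarrow> nat"
  shows "(\<lambda>(a, b). w a + v b) -` {k} = (\<Union>i\<in>{0..k}. (w -` {i}) \<times> (v -` {k - i}))"
  by auto

lemma finite_fibres_sum:
  assumes "finite_fibres w" "finite_fibres v"
  shows "finite_fibres (\<lambda>(a, b). w a + v b)"
  unfolding finite_fibres_def vimage_sum_weight
  using assms by (auto simp: finite_fibres_def intro!: finite_cartesian_product)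

lemma count_series_mult:
  assumes "finite_fibres w" "finite_fibres v"
  shows "count_series w * count_series v = count_series (\<lambda>(a, b). w a + v b)"
proof (rule fps_ext)
  fix k
  have "card ((\<lambda>(a, b). w a + v b) -` {k}) = (\<Sum>i=0..k. card ((w -` {i}) \<times> (v -` {k - i})))"
    unfolding vimage_sum_weight
    using assms by (intro card_UN_disjoint) (auto simp: finite_fibres_def intro!: finite_cartesian_product)
  thus "fps_nth (count_series w * count_series v) k =
        fps_nth (count_series (\<lambda>(a, b). w a + v b)) k"
    by (simp add: fps_mult_nth card_cartesian_product)
qed

lemma finite_fibres_mult:
  assumes "finite_fibres w" "c > 0"
  shows "finite_fibres (\<lambda>a. c * w a)"
  unfolding finite_fibres_def
proof
  fix k
  have "(\<lambda>a. c * w a) -` {k} \<subseteq> w -` {k div c}" using assms by auto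
  thus "finite ((\<lambda>a. c * w a) -` {k})"
    using assms finite_subset unfolding finite_fibres_def by blast
qed

text \<open>Swapping the entries pairs off the off-diagonal pairs, so only the diagonal counts
  modulo 2. The linear order picks one pair out of each swap orbit.\<close>

lemma count_series_square_bit:
  fixes w :: "'i::linorder \<Rightarrow> nat"
  assumes "finite_fibres w"
  shows "(count_series w :: bit fps) ^ 2 = count_series (\<lambda>a. 2 * w a)"
proof (rule fps_ext)
  fix k
  define S where "S = (\<lambda>(a, b). w a + w b) -` {k}"
  define L where "L = {z \<in> S. fst z < snd z}"
  define G where "G = {z \<in> S. snd z < fst z}"
  define E where "E = {z \<in> S. fst z = snd z}"
  have fin: "finite S"
    using finite_fibres_sum[OF assms assms] by (simp add: finite_fibres_def S_def)
  have "S = (L \<union> G) \<union> E" by (auto simp: L_def G_def E_def)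
  moreover have "card ((L \<union> G) \<union> E) = card (L \<union> G) + card E"
    using fin by (intro card_Un_disjoint) (auto simp: L_def G_def E_def)
  moreover have "card (L \<union> G) = card L + card G"
    using fin by (intro card_Un_disjoint) (auto simp: L_def G_def)
  moreover have "card L = card G"
    by (rule bij_betw_same_card[of prod.swap], rule bij_betw_byWitness[of _ prod.swap])
       (auto simp: L_def G_def S_def)
  moreover have "card E = card ((\<lambda>a. 2 * w a) -` {k})"
    by (rule bij_betw_same_card[of fst], rule bij_betw_byWitness[of _ "\<lambda>a. (a, a)"])
       (auto simp: E_def S_def)
  ultimately have "card S = 2 * card L + card ((\<lambda>a. 2 * w a) -` {k})"
    by simp
  hence "(of_nat (card S) :: bit) = of_nat (card ((\<lambda>a. 2 * w a) -` {k}))"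
    by (simp only: of_nat_add of_nat_mult of_nat_numeral bit_2_eq_0 mult_zero_left add_0_left)
  thus "fps_nth ((count_series w :: bit fps) ^ 2) k =
        fps_nth (count_series (\<lambda>a. 2 * w a)) k"
    using assms by (simp add: power2_eq_square count_series_mult S_def)
qed

text \<open>\<open>h\<close> is \<open>g\<close> with \<open>X ^ d\<close> for \<open>X\<close>.
  Multiplying by it preserves exponents modulo \<open>d\<close>, so each residue class
  \<open>r\<close> can be treated separately.\<close>

lemma fps_nth_mult_stretch:
  fixes f g h :: "'a::comm_ring_1 fps"
  assumes h: "\<And>k. fps_nth h k = (if d dvd k then fps_nth g (k div d) else 0)"
    and "r < d"
  shows "fps_nth (f * h) (d * t + r) = fps_nth (Abs_fps (\<lambda>t. fps_nth f (d * t + r)) * g) t"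
proof -
  have "fps_nth (f * h) (d * t + r) = (\<Sum>i=0..d*t+r. fps_nth h i * fps_nth f (d * t + r - i))"
    by (simp add: fps_mult_nth mult.commute[of f])
  also have "\<dots> = (\<Sum>i\<in>(*) d ` {0..t}. fps_nth h i * fps_nth f (d * t + r - i))"
  proof (rule sum.mono_neutral_right)
    show "\<forall>i\<in>{0..d*t+r} - (*) d ` {0..t}. fps_nth h i * fps_nth f (d * t + r - i) = 0"
    proof
      fix i assume i: "i \<in> {0..d*t+r} - (*) d ` {0..t}"
      have "\<not> d dvd i"
      proof
        assume "d dvd i"
        then obtain j where j: "i = d * j" by auto
        have "d * j < d * (t + 1)" using i j assms(2) by auto
        hence "j < t + 1" by (rule mult_less_cancel1[THEN iffD1, THEN conjunct2])
        hence "j \<le> t" by simp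
        thus False using i j by auto
      qed
      thus "fps_nth h i * fps_nth f (d * t + r - i) = 0" by (simp add: h)
    qed
  next
    show "(*) d ` {0..t} \<subseteq> {0..d*t+r}" by (auto intro!: trans_le_add1)
  qed auto
  also have "\<dots> = (\<Sum>i=0..t. fps_nth h (d * i) * fps_nth f (d * t + r - d * i))"
    using assms(2) by (subst sum.reindex) (auto simp: inj_on_def)
  also have "\<dots> = (\<Sum>i=0..t. fps_nth g i * fps_nth f (d * (t - i) + r))"
    using assms(2) by (intro sum.cong) (auto simp: h diff_mult_distrib2)
  finally show ?thesis by (simp add: fps_mult_nth mult.commute[of _ g])
qed

section \<open>The false theta function and its reciprocal modulo 2\<close>

text \<open>Completing the square,
  \<open>7 * (7 * n ^ 2 + b * n) = (7 * n + b / 2) ^ 2 - (b / 2) ^ 2\<close>. For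
  \<open>\<bar>b\<bar> \<le> 7\<close> nothing is truncated by \<open>nat\<close>.\<close>

definition quad_weight :: "int \<Rightarrow> int \<Rightarrow> nat" where
  "quad_weight b n = nat (7 * n ^ 2 + b * n)"

lemma of_nat_quad_weight:
  assumes "\<bar>b\<bar> \<le> 7"
  shows "int (quad_weight b n) = 7 * n ^ 2 + b * n"
proof -
  have "\<bar>b * n\<bar> \<le> 7 * \<bar>n\<bar>" using assms by (simp add: abs_mult mult_right_mono)
  moreover have "\<bar>n\<bar> \<le> n ^ 2"
    using self_le_power[of "\<bar>n\<bar>" 2] by (cases "n = 0") auto
  ultimately show ?thesis by (simp add: quad_weight_def)
qed

lemma finite_fibres_quad_weight:
  assumes "\<bar>b\<bar> < 7"
  shows "finite_fibres (quad_weight b)"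
  unfolding finite_fibres_def
proof
  fix k
  have "quad_weight b -` {k} \<subseteq> {-int k..int k}"
  proof
    fix n assume "n \<in> quad_weight b -` {k}"
    hence "int k = 7 * n ^ 2 + b * n" using of_nat_quad_weight[of b n] assms by auto
    \<comment> \<open>The strict bound on \<open>b\<close> leaves
      \<open>k \<ge> 7 * n ^ 2 - 6 * \<bar>n\<bar> \<ge> \<bar>n\<bar>\<close>.\<close>
    moreover have "\<bar>b * n\<bar> \<le> 6 * \<bar>n\<bar>" using assms by (simp add: abs_mult mult_right_mono)
    moreover have "\<bar>n\<bar> \<le> n ^ 2"
      using self_le_power[of "\<bar>n\<bar>" 2] by (cases "n = 0") auto
    ultimately show "n \<in> {-int k..int k}" by auto
  qed
  thus "finite (quad_weight b -` {k})" by (rule finite_subset) auto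
qed

text \<open>In \<open>bit\<close> both the factors \<open>(-1) ^ u\<close> and the minus sign before
  the sum over negative \<open>n\<close> disappear, leaving a plain count of exponents.\<close>

lemma false_theta_nth_bit:
  "of_int (fps_nth (false_theta (- (fps_X ^ 11)) (fps_X ^ 3)) k) =
     fps_nth (count_series (quad_weight 4) :: bit fps) k"
proof -
  define f where "f = (\<lambda>n::int. (- (fps_X ^ 11)) ^ nat (n * (n + 1) div 2) *
                          (fps_X ^ 3) ^ nat (n * (n - 1) div 2) :: int fps)"
  have ex: "11 * nat (n * (n + 1) div 2) + 3 * nat (n * (n - 1) div 2) = quad_weight 4 n" for n
  proof -
    define a b where "a = n * (n + 1) div 2" and "b = n * (n - 1) div 2"
    have ab: "2 * a = n * (n + 1)" "2 * b = n * (n - 1)" by (simp_all add: a_def b_def)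
    have "n * (n + 1) \<ge> 0" "n * (n - 1) \<ge> 0" by (auto simp: zero_le_mult_iff)
    hence nn: "a \<ge> 0" "b \<ge> 0" using ab by linarith+
    have "int (11 * nat a + 3 * nat b) = int (quad_weight 4 n)"
      using ab nn by (simp add: of_nat_quad_weight power2_eq_square algebra_simps)
    thus ?thesis by (simp only: a_def b_def of_nat_eq_iff)
  qed
  have f: "fps_nth (f n) k = (if quad_weight 4 n = k
      then (-1) ^ nat (n * (n + 1) div 2) else 0)" for n
    unfolding f_def by (subst false_theta_term_nth, subst ex) auto
  define P N where "P = {n \<in> quad_weight 4 -` {k}. n \<ge> 0}" and "N = {n \<in> quad_weight 4 -` {k}. n \<le> -1}"
  have sets: "{n. n \<ge> 0 \<and> fps_nth (f n) k \<noteq> 0} = P" "{n. n \<le> -1 \<and> fps_nth (f n) k \<noteq> 0} = N"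
    by (auto simp: f P_def N_def)
  have s: "of_int (\<Sum>n\<in>A. fps_nth (f n) k) = (of_nat (card A) :: bit)"
    if "A \<subseteq> quad_weight 4 -` {k}" for A
  proof -
    have "of_int (fps_nth (f n) k) = (1 :: bit)" if "n \<in> A" for n
      using that \<open>A \<subseteq> _\<close> by (auto simp: f)
    thus ?thesis by simp
  qed
  have "finite (quad_weight 4 -` {k})"
    using finite_fibres_quad_weight[of 4] by (simp add: finite_fibres_def)
  hence "card P + card N = card (P \<union> N)"
    by (intro card_Un_disjoint[symmetric]) (auto simp: P_def N_def intro: finite_subset[rotated])
  also have "P \<union> N = quad_weight 4 -` {k}" by (auto simp: P_def N_def)
  finally have c: "card P + card N = card (quad_weight 4 -` {k})" .
  have "fps_nth (false_theta (- (fps_X ^ 11)) (fps_X ^ 3)) k =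
      (\<Sum>n\<in>P. fps_nth (f n) k) - (\<Sum>n\<in>N. fps_nth (f n) k)"
    unfolding sets[symmetric] f_def by (rule false_theta_nth(3)) auto
  hence "of_int (fps_nth (false_theta (- (fps_X ^ 11)) (fps_X ^ 3)) k) =
      (of_nat (card P) - of_nat (card N) :: bit)"
    using s[of P] s[of N] by (simp add: P_def N_def subset_iff)
  thus ?thesis by (simp flip: c)
qed

lemma false_theta_coeff_inverse:
  assumes "r > 0" "s > 0"
  shows "Abs_fps (false_theta_coeff r s) * false_theta (- (fps_X ^ r)) (fps_X ^ s) = 1"
  unfolding false_theta_coeff_def by (rule theI'[OF ex1_false_theta_coeff[OF assms]])

text \<open>Reduction modulo 2 is a ring homomorphism, so the defining identity over the integers
  carries over.\<close>

lemma false_theta_coeff_bit_inverse: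
  "Abs_fps (\<lambda>n. of_int (false_theta_coeff 11 3 n)) * (count_series (quad_weight 4) :: bit fps) = 1"
proof (rule fps_ext)
  fix k
  have "fps_nth (Abs_fps (\<lambda>n. of_int (false_theta_coeff 11 3 n)) *
          (count_series (quad_weight 4) :: bit fps)) k =
        of_int (fps_nth (Abs_fps (false_theta_coeff 11 3) *
          false_theta (- (fps_X ^ 11)) (fps_X ^ 3)) k)"
    by (simp add: fps_mult_nth false_theta_nth_bit del: count_series_nth)
  also have "\<dots> = fps_nth 1 k" by (subst false_theta_coeff_inverse) auto
  finally show "fps_nth (Abs_fps (\<lambda>n. of_int (false_theta_coeff 11 3 n)) *
          (count_series (quad_weight 4) :: bit fps)) k = fps_nth 1 k" .
qed

section \<open>The coefficients at exponents 4 modulo 8\<close>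

definition ternary_weight :: "int \<times> int \<times> int \<Rightarrow> nat" where
  "ternary_weight = (\<lambda>(x, y, z). quad_weight 4 x + (2 * quad_weight 4 y + 4 * quad_weight 4 z))"

text \<open>The added 1 makes 7 times this weight plus 3 equal to
  \<open>(7 * n + 1) ^ 2 + (7 * m + 3) ^ 2\<close>. The \<open>Suc\<close> sits on the second
  summand to keep the shape required by \<open>finite_fibres_sum\<close>.\<close>

definition binary_weight :: "int \<times> int \<Rightarrow> nat" where
  "binary_weight = (\<lambda>(n, m). quad_weight 2 n + Suc (quad_weight 6 m))"

lemma finite_fibres_binary_weight: "finite_fibres binary_weight"
proof -
  have "finite_fibres (\<lambda>m. Suc (quad_weight 6 m))"
    unfolding finite_fibres_def
  proof
    fix k
    \<comment> \<open>At \<open>k = 0\<close> the left side is empty, so truncated subtraction is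
      harmless.\<close>
    have "(\<lambda>m. Suc (quad_weight 6 m)) -` {k} \<subseteq> quad_weight 6 -` {k - 1}" by auto
    thus "finite ((\<lambda>m. Suc (quad_weight 6 m)) -` {k})"
      using finite_fibres_quad_weight[of 6] by (auto simp: finite_fibres_def intro: finite_subset)
  qed
  thus ?thesis
    unfolding binary_weight_def by (intro finite_fibres_sum finite_fibres_quad_weight) auto
qed

text \<open>
  With \<open>X = 7x + 2\<close> and so on, 7 times the ternary weight plus 28 is \<open>X\<^sup>2 + 2 Y\<^sup>2 + 4 Z\<^sup>2\<close>.
  When this form is divisible by 8, then \<open>X = 2 U\<close> and \<open>Y = 2 V\<close> with \<open>U \<equiv> Z\<close> modulo 2, and an eighth of the form equals
  \<open>((U + Z) / 2)\<^sup>2 + ((U - Z) / 2)\<^sup>2 + V\<^sup>2\<close>.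
\<close>

lemma card_ternary_weight:
  "card (ternary_weight -` {8 * t + 4}) =
   card ((\<lambda>(a, s). binary_weight a + quad_weight 4 s) -` {t})"
proof -
  let ?T = "ternary_weight -` {8 * t + 4}"
  let ?B = "(\<lambda>(a, s). binary_weight a + quad_weight 4 s) -` {t}"
  \<comment> \<open>Obtained by solving \<open>V = 7 * n + 1\<close>,
    \<open>(U - Z) / 2 = 7 * m + 3\<close> and \<open>(U + Z) / 2 = - (7 * s + 2)\<close> for
    \<open>x\<close>, \<open>y\<close>, \<open>z\<close>.\<close>
  define g :: "(int \<times> int) \<times> int \<Rightarrow> int \<times> int \<times> int"
    where "g = (\<lambda>((n, m), s). (2 * (m - s), 2 * n, - s - 1 - m))"
  have weight: "ternary_weight (g a) =
      8 * (case a of (a, s) \<Rightarrow> binary_weight a + quad_weight 4 s) + 4" for a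
  proof -
    obtain n m s where a: "a = ((n, m), s)" by (metis surj_pair)
    have "int (ternary_weight (g a)) =
        int (8 * (case a of (a, s) \<Rightarrow> binary_weight a + quad_weight 4 s) + 4)"
      by (simp add: a g_def ternary_weight_def binary_weight_def of_nat_quad_weight
          power2_eq_square algebra_simps)
    thus ?thesis by (simp only: of_nat_eq_iff)
  qed
  have "g ` ?B = ?T"
  proof (intro equalityI subsetI)
    fix w assume w: "w \<in> ?T"
    obtain x y z where xyz: "w = (x, y, z)" by (metis surj_pair)
    have eq: "7 * x ^ 2 + 4 * x + 2 * (7 * y ^ 2 + 4 * y) + 4 * (7 * z ^ 2 + 4 * z) = 8 * int t + 4"
    proof -
      have "int (ternary_weight w) = int (8 * t + 4)" using w by simp
      thus ?thesis by (simp add: xyz ternary_weight_def of_nat_quad_weight)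
    qed
    \<comment> \<open>Modulo 2 the equation makes \<open>x\<close> even; halved, it makes
      \<open>y\<close> even; halved again, it makes \<open>i\<close> and \<open>z\<close> of
      opposite parity.\<close>
    have "even (7 * x ^ 2)"
    proof -
      have "7 * x ^ 2 = 2 * (4 * int t + 2 - 2 * x - (7 * y ^ 2 + 4 * y) - 2 * (7 * z ^ 2 + 4 * z))"
        using eq by (simp add: algebra_simps)
      thus ?thesis by (metis dvd_triv_left)
    qed
    hence "even x" by simp
    then obtain i where i: "x = 2 * i" by auto
    have "7 * y ^ 2 = 2 * (2 * int t + 1 - 7 * i ^ 2 - 2 * i - 2 * y - (7 * z ^ 2 + 4 * z))"
      using eq by (simp add: i algebra_simps power2_eq_square)
    hence "even (7 * y ^ 2)" by (metis dvd_triv_left)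
    hence "even y" by simp
    then obtain j where j: "y = 2 * j" by auto
    have sq: "7 * (i ^ 2 + z ^ 2) = 2 * (int t - i - 7 * j ^ 2 - 2 * j - 2 * z) + 1"
      using eq by (simp add: i j algebra_simps power2_eq_square)
    have "odd (7 * (i ^ 2 + z ^ 2))" unfolding sq by simp
    hence "even (i - z - 1)" by auto
    then obtain m where m: "i - z - 1 = 2 * m" by (rule evenE)
    have "w = g ((j, m), m - i)" using m by (simp add: xyz i j g_def algebra_simps)
    moreover from this have "((j, m), m - i) \<in> ?B" using w weight[of "((j, m), m - i)"] by simp
    ultimately show "w \<in> g ` ?B" by blast
  qed (auto simp: weight simp flip: case_prod_unfold)
  moreover have "inj_on g ?B" by (auto simp: g_def inj_on_def)
  ultimately have "bij_betw g ?B ?T" by (simp add: bij_betw_def)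
  thus ?thesis by (rule bij_betw_same_card[symmetric])
qed

lemma false_theta_coeff_8_4:
  "of_int (false_theta_coeff 11 3 (8 * t + 4)) = (of_nat (card (binary_weight -` {t})) :: bit)"
proof -
  let ?F = "count_series (quad_weight 4) :: bit fps"
  let ?D = "Abs_fps (\<lambda>n. of_int (false_theta_coeff 11 3 n)) :: bit fps"
  let ?H = "count_series (\<lambda>n. 8 * quad_weight 4 n) :: bit fps"
  note fin = finite_fibres_quad_weight[of 4, simplified]
  have F2: "?F ^ 2 = count_series (\<lambda>n. 2 * quad_weight 4 n)"
    by (rule count_series_square_bit[OF fin])
  have "(?F ^ 2) ^ 2 = count_series (\<lambda>n. 2 * (2 * quad_weight 4 n))"
    unfolding F2 by (intro count_series_square_bit finite_fibres_mult fin) auto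
  hence F4: "?F ^ 4 = count_series (\<lambda>n. 4 * quad_weight 4 n)"
    by (simp flip: power_mult)
  have "(?F ^ 4) ^ 2 = count_series (\<lambda>n. 2 * (4 * quad_weight 4 n))"
    unfolding F4 by (intro count_series_square_bit finite_fibres_mult fin) auto
  hence F8: "?F ^ 8 = ?H"
    by (simp flip: power_mult)
  have inv: "?D * ?F = 1" by (rule false_theta_coeff_bit_inverse)
  \<comment> \<open>One factor \<open>?F\<close> is reserved to cancel against \<open>?D\<close>;
    the other three form the ternary series.\<close>
  have "?F ^ (1 + 1 + 2 + 4) = ?F * ?F * ?F ^ 2 * ?F ^ 4"
    by (simp only: power_add power_one_right)
  hence "?H = ?F * (?F * (?F ^ 2 * ?F ^ 4))"
    by (simp only: F8[symmetric] mult.assoc) simp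
  hence "?D * ?H = (?D * ?F) * (?F * (?F ^ 2 * ?F ^ 4))"
    by (simp only: mult.assoc)
  also have "\<dots> = count_series ternary_weight"
  proof -
    have "?F ^ 2 * ?F ^ 4 = count_series (\<lambda>(y, z). 2 * quad_weight 4 y + 4 * quad_weight 4 z)"
      unfolding F2 F4 by (intro count_series_mult finite_fibres_mult fin) auto
    moreover have "?F * count_series (\<lambda>(y, z). 2 * quad_weight 4 y + 4 * quad_weight 4 z) =
        count_series (\<lambda>(x, b). quad_weight 4 x + (case b of (y, z) \<Rightarrow> 2 * quad_weight 4 y + 4 * quad_weight 4 z))"
      by (intro count_series_mult finite_fibres_mult finite_fibres_sum fin) auto
    ultimately show ?thesis by (simp add: inv ternary_weight_def case_prod_unfold)
  qed
  finally have DH: "?D * ?H = count_series ternary_weight" .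
  have H: "fps_nth ?H k = (if 8 dvd k then fps_nth ?F (k div 8) else 0)" for k
  proof (cases "8 dvd k")
    case True
    then obtain l where "k = 8 * l" by auto
    thus ?thesis by (simp add: vimage_def)
  next
    case False
    hence "(\<lambda>n. 8 * quad_weight 4 n) -` {k} = {}" by auto
    thus ?thesis using False by simp
  qed
  \<comment> \<open>Comparing the terms \<open>8 * t + 4\<close> of \<open>DH\<close>: on the left
    \<open>?H\<close> shrinks to \<open>?F\<close>, on the right the bijection splits off
    \<open>?F\<close>. This nonzero factor then cancels.\<close>
  have "Abs_fps (\<lambda>t. fps_nth ?D (8 * t + 4)) * ?F = count_series binary_weight * ?F"
  proof (rule fps_ext)
    fix t
    have "fps_nth (Abs_fps (\<lambda>t. fps_nth ?D (8 * t + 4)) * ?F) t = fps_nth (?D * ?H) (8 * t + 4)"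
      by (rule fps_nth_mult_stretch[symmetric]) (rule H, simp)
    also have "\<dots> = of_nat (card (ternary_weight -` {8 * t + 4}))"
      by (simp add: DH)
    also have "\<dots> = fps_nth (count_series binary_weight * ?F) t"
      by (simp add: card_ternary_weight count_series_mult finite_fibres_binary_weight fin)
    finally show "fps_nth (Abs_fps (\<lambda>t. fps_nth ?D (8 * t + 4)) * ?F) t =
        fps_nth (count_series binary_weight * ?F) t" .
  qed
  moreover have "?F \<noteq> 0" using inv by auto
  ultimately have "Abs_fps (\<lambda>t. fps_nth ?D (8 * t + 4)) = count_series binary_weight"
    by simp
  from arg_cong[OF this, of "\<lambda>f. fps_nth f t"] show ?thesis by simp
qed

section \<open>Primes 3 modulo 4 and sums of two squares\<close>

text \<open>Otherwise \<open>p\<close> divides neither number, and raising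
  \<open>x ^ 2 = - (y ^ 2)\<close> modulo \<open>p\<close> to the odd power
  \<open>(p - 1) / 2\<close> gives \<open>1 = - 1\<close> by Fermat.\<close>

lemma prime_3_mod_4_dvd_sum_squares:
  fixes x y :: int
  assumes "prime p" "p mod 4 = (3 :: nat)" "int p dvd x ^ 2 + y ^ 2"
  shows "int p dvd x"
proof (rule ccontr)
  assume x: "\<not> int p dvd x"
  have p: "prime (int p)" using assms(1) by simp
  have y: "\<not> int p dvd y"
  proof
    assume "int p dvd y"
    hence "int p dvd y ^ 2" by (simp add: power2_eq_square)
    hence "int p dvd x ^ 2" using assms(3) by (simp add: dvd_add_left_iff)
    thus False using x p prime_dvd_power by blast
  qed
  define h where "h = (p - 1) div 2"
  have h: "p - 1 = 2 * h" "odd h" using assms(2) unfolding h_def by presburger+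
  have fermat: "[z ^ (p - 1) = 1] (mod int p)" if "\<not> int p dvd z" for z
  proof -
    have "\<not> p dvd nat \<bar>z\<bar>" using that by (simp add: int_dvd_int_iff[symmetric])
    hence "[nat \<bar>z\<bar> ^ (p - 1) = 1] (mod p)" by (rule fermat_theorem[OF assms(1)])
    hence "[int (nat \<bar>z\<bar> ^ (p - 1)) = int 1] (mod int p)" by (simp only: cong_int_iff)
    moreover have "\<bar>z\<bar> ^ (p - 1) = z ^ (p - 1)" using h(1) by (intro power_even_abs) simp
    ultimately show ?thesis by simp
  qed
  have "[x ^ 2 = - (y ^ 2)] (mod int p)"
    using assms(3) by (simp add: cong_iff_dvd_diff)
  hence "[(x ^ 2) ^ h = (- (y ^ 2)) ^ h] (mod int p)" by (rule cong_pow)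
  hence "[x ^ (p - 1) = - (y ^ (p - 1))] (mod int p)"
    using h by (simp add: power_mult)
  moreover have "[- (y ^ (p - 1)) = - 1] (mod int p)"
    using fermat[OF y] by (simp add: cong_minus_minus_iff)
  ultimately have "[1 = - 1] (mod int p)"
    using fermat[OF x] by (meson cong_sym cong_trans)
  hence "int p dvd 2" by (simp add: cong_iff_dvd_diff)
  hence "int p \<le> 2" by (rule zdvd_imp_le) simp
  moreover have "p \<ge> 3" using assms(2) by presburger
  ultimately show False by simp
qed

text \<open>Descent: \<open>p\<close> divides both \<open>x\<close> and \<open>y\<close>, and
  dividing them by \<open>p\<close> lowers the exponent by 2.\<close>

lemma sum_squares_neq_odd_prime_power:
  fixes x y c :: int
  assumes "prime p" "p mod 4 = (3 :: nat)" "\<not> int p dvd c"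
  shows "x ^ 2 + y ^ 2 \<noteq> int p ^ (2 * m + 1) * c"
proof (induction m arbitrary: x y)
  have p0: "int p \<noteq> 0" using assms(1) by auto
  \<comment> \<open>Only one factor \<open>p\<close> is split off: \<open>d = c\<close> contradicts
    the hypothesis in the base case, and in the induction step \<open>d\<close> holds the second
    factor.\<close>
  have descent: "\<exists>u v. x = int p * u \<and> y = int p * v \<and> int p * (u ^ 2 + v ^ 2) = d"
    if "x ^ 2 + y ^ 2 = int p * d" for x y d
  proof -
    have "int p dvd x" "int p dvd y"
      using prime_3_mod_4_dvd_sum_squares[OF assms(1,2), of x y]
        prime_3_mod_4_dvd_sum_squares[OF assms(1,2), of y x] that by (simp_all add: add.commute)
    then obtain u v where uv: "x = int p * u" "y = int p * v" by (elim dvdE)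
    have "int p * (int p * (u ^ 2 + v ^ 2)) = int p * d"
      using that by (simp add: uv power2_eq_square algebra_simps)
    thus ?thesis using uv p0 by auto
  qed
  {
    case 0
    show ?case
    proof
      assume "x ^ 2 + y ^ 2 = int p ^ (2 * 0 + 1) * c"
      with descent[of x y c] obtain u v where "int p * (u ^ 2 + v ^ 2) = c" by auto
      thus False using assms(3) by auto
    qed
  next
    case (Suc m)
    show ?case
    proof
      assume "x ^ 2 + y ^ 2 = int p ^ (2 * Suc m + 1) * c"
      hence "x ^ 2 + y ^ 2 = int p * (int p * (int p ^ (2 * m + 1) * c))" by (simp add: mult_ac)
      from descent[OF this] obtain u v
        where "int p * (u ^ 2 + v ^ 2) = int p * (int p ^ (2 * m + 1) * c)" by blast
      hence "u ^ 2 + v ^ 2 = int p ^ (2 * m + 1) * c" using p0 by simp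
      thus False using Suc.IH by blast
    qed
  }
qed

section \<open>The congruence\<close>

lemma binary_weight_eq_imp_sum_squares:
  assumes "binary_weight (n, m) = t"
  shows "(7 * n + 1) ^ 2 + (7 * m + 3) ^ 2 = 7 * int t + 3"
proof -
  have "int t = 7 * n ^ 2 + 2 * n + 7 * m ^ 2 + 6 * m + 1"
    by (simp flip: assms add: binary_weight_def of_nat_quad_weight)
  thus ?thesis by (simp add: power2_eq_square algebra_simps)
qed

theorem theorem5p2:
  fixes p m n k :: nat
  assumes "prime p" and "[p = 15] (mod 28) \<or> [p = 27] (mod 28)" and "\<not> p dvd n"
  shows "[false_theta_coeff 11 3
            (2 ^ (3 * k + 3) * p ^ (2 * m + 1) * n + (3 * 2 ^ (3 * k + 3) * p ^ (2 * m + 2) + 4) div 7) = 0] (mod 2)"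
proof -
  have "p mod 28 mod 4 = p mod 4" "p mod 28 mod 7 = p mod 7"
    by (simp_all add: mod_mod_cancel)
  hence p4: "p mod 4 = 3" and p7: "p mod 7 = 1 \<or> p mod 7 = 6"
    using assms(2) by (auto simp: cong_def)
  \<comment> \<open>The cofactor of \<open>p ^ (2 * m + 1)\<close> in \<open>7 * t + 3\<close>,
    where the index is \<open>8 * t + 4\<close>.\<close>
  define c where "c = 8 ^ k * (7 * n + 3 * p)"
  define N where "N = 2 ^ (3 * k + 3) * p ^ (2 * m + 1) * n + (3 * 2 ^ (3 * k + 3) * p ^ (2 * m + 2) + 4) div 7"
  have two: "2 ^ (3 * k + 3) = 8 * (8::nat) ^ k" by (simp add: power_add power_mult)
  \<comment> \<open>The \<open>div 7\<close> is exact, because 8 and \<open>p * p\<close> are both 1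
    modulo 7.\<close>
  have "[3 * 2 ^ (3 * k + 3) * p ^ (2 * m + 2) + 4 = 3 * 1 * 1 + 4] (mod 7)"
  proof (intro cong_add cong_mult cong_refl)
    have "[(8::nat) ^ (k + 1) = 1 ^ (k + 1)] (mod 7)" by (rule cong_pow) (simp add: cong_def)
    thus "[2 ^ (3 * k + 3) = 1] (mod (7::nat))" unfolding two by simp
    have "p * p mod 7 = 1" using p7 by (subst mod_mult_eq[symmetric]) auto
    hence "[p * p = 1] (mod 7)" by (simp add: cong_def)
    hence "[(p * p) ^ (m + 1) = 1 ^ (m + 1)] (mod 7)" by (rule cong_pow)
    moreover have "p ^ (2 * m + 2) = (p * p) ^ (m + 1)"
      by (simp flip: power2_eq_square power_mult)
    ultimately show "[p ^ (2 * m + 2) = 1] (mod 7)" by (simp only: power_one)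
  qed
  hence "7 dvd 3 * 2 ^ (3 * k + 3) * p ^ (2 * m + 2) + 4" by (simp add: cong_def dvd_eq_mod_eq_0)
  hence N: "7 * N = 8 * (p ^ (2 * m + 1) * c) + 4"
    unfolding N_def c_def two by (simp add: algebra_simps power_add)
  \<comment> \<open>Since 7 is -1 modulo 8, \<open>N\<close> is -4, that is 4, modulo 8.\<close>
  hence "N mod 8 = 4" by presburger
  then obtain t where t: "N = 8 * t + 4" by (metis mult_div_mod_eq)
  have M: "7 * t + 3 = p ^ (2 * m + 1) * c" using N t by linarith
  \<comment> \<open>The residues of \<open>p\<close> exclude 2 and 7, so a divisor \<open>p\<close>
    of \<open>c\<close> would divide \<open>n\<close>.\<close>
  have ndvd: "\<not> p dvd c"
  proof
    assume "p dvd c"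
    hence "p dvd 8 ^ k \<or> p dvd 7 * n + 3 * p"
      using assms(1) by (simp add: c_def prime_dvd_mult_iff)
    thus False
    proof
      assume "p dvd 8 ^ k"
      hence "p dvd 2 ^ (3 * k)" by (simp add: power_mult)
      hence "p dvd 2" by (rule prime_dvd_power[OF assms(1)])
      hence "p \<le> 2" by (rule dvd_imp_le) simp
      thus False using p4 by presburger
    next
      assume "p dvd 7 * n + 3 * p"
      hence "p dvd 7 * n" by (simp add: dvd_add_left_iff)
      hence "p dvd 7" using assms by (simp add: prime_dvd_mult_iff)
      hence "p = 7" using assms(1) by (simp add: primes_dvd_imp_eq)
      thus False using p7 by simp
    qed
  qed
  have "binary_weight -` {t} = {}"
  proof -
    have False if w: "binary_weight (a, b) = t" for a b
    proof -
      have "(7 * a + 1) ^ 2 + (7 * b + 3) ^ 2 = int (7 * t + 3)"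
        using binary_weight_eq_imp_sum_squares[OF w] by simp
      also have "\<dots> = int p ^ (2 * m + 1) * int c" by (simp add: M)
      finally show False
        using sum_squares_neq_odd_prime_power[OF assms(1) p4, of "int c"] ndvd by simp
    qed
    thus ?thesis by auto
  qed
  hence "(of_int (false_theta_coeff 11 3 N) :: bit) = 0"
    by (simp add: t false_theta_coeff_8_4)
  hence "even (false_theta_coeff 11 3 N)" by (rule of_int_bit_eq_0_imp_even)
  thus ?thesis by (simp add: N_def cong_0_iff)
qed

end
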